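(* Let $c\ge 1$ and $t \ge 1$ be integers and let $G$ be a graph on $n$ vertices which is the complement of a $c$-closed graph. Then the number of inclusion-maximal sets $S \subseteq V(G)$ such that $\mathrm{tw}(G[S]) \le t$ is at most $3 n^{t+4} 2^{2(c-1)}$.
   Context: Graphs are finite, simple and undirected. A graph $H$ is $c$-closed if any two non-adjacent vertices of $H$ have at most $c-1$ common neighbors; $G$ is the complement of a $c$-closed graph iff for any two adjacent vertices $u,v$ of $G$ at most $c-1$ vertices of $G$ are adjacent to neither $u$ nor $v$ (excluding $u,v$). $\mathrm{tw}$ denotes treewidth.
   Formalization: The graph is assumed to have at least one vertex (n ≥ 1); for the null graph the stated bound is 0, although the empty set is one inclusion-maximal set. *)

theory Defs
  imports "Graph_Theory.Digraph_Component"
begin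

text \<open>
  A finite simple undirected graph is a \<^locale>\<open>pair_graph\<close>: a finite, loop-free, symmetric
  digraph without parallel arcs, each edge being represented by its two orientations.
\<close>

definition graph_complement :: "'a pair_pre_digraph \<Rightarrow> 'a pair_pre_digraph" where
  "graph_complement G =
     \<lparr>pverts = pverts G,
      parcs = {(u, v). u \<in> pverts G \<and> v \<in> pverts G \<and> u \<noteq> v \<and> (u, v) \<notin> parcs G}\<rparr>"

definition c_closed :: "nat \<Rightarrow> 'a pair_pre_digraph \<Rightarrow> bool" where
  "c_closed c H \<longleftrightarrow>
     (\<forall>u \<in> pverts H. \<forall>v \<in> pverts H. u \<noteq> v \<and> (u, v) \<notin> parcs H \<longrightarrow>
        card {w \<in> pverts H. (u, w) \<in> parcs H \<and> (v, w) \<in> parcs H} \<le> c - 1)"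

text \<open>
  The library predicate \<^const>\<open>tree\<close> forbids all directed cycles, so a symmetric digraph with at
  least one edge never satisfies it: going back and forth along an edge is a directed cycle of
  length 2. The cycles of an undirected graph are the directed cycles of length at least 3 of its
  symmetric representation. As \<^const>\<open>connected\<close> includes nonemptiness, a tree has at least
  one node.
\<close>

definition undirected_tree :: "'a pair_pre_digraph \<Rightarrow> bool" where
  "undirected_tree T \<longleftrightarrow>
     pair_graph T \<and> connected (with_proj T) \<and>
     \<not> (\<exists>p. pre_digraph.cycle (with_proj T) p \<and> 3 \<le> length p)"

definition tree_decomposition ::
    "('a, 'b) pre_digraph \<Rightarrow> 'n pair_pre_digraph \<Rightarrow> ('n \<Rightarrow> 'a set) \<Rightarrow> bool" where
  "tree_decomposition G T B \<longleftrightarrow>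
     undirected_tree T \<and>
     (\<Union>x \<in> pverts T. B x) = verts G \<and>
     (\<forall>u v. u \<rightarrow>\<^bsub>G\<^esub> v \<longrightarrow> (\<exists>x \<in> pverts T. u \<in> B x \<and> v \<in> B x)) \<and>
     (\<forall>v \<in> verts G. connected (with_proj T \<restriction> {x \<in> pverts T. v \<in> B x}))"

definition decomposition_width :: "'n pair_pre_digraph \<Rightarrow> ('n \<Rightarrow> 'a set) \<Rightarrow> int" where
  "decomposition_width T B = Max ((\<lambda>x. int (card (B x))) ` pverts T) - 1"

text \<open>
  Decomposition trees are finite, so it is no restriction to take natural numbers as their nodes.
  For a finite graph the set of widths is nonempty and bounded below by \<open>-1\<close>, so the infimum is a
  minimum; the graph without vertices has treewidth \<open>-1\<close>.
\<close>

definition treewidth :: "('a, 'b) pre_digraph \<Rightarrow> int" where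
  "treewidth G =
     Inf {decomposition_width T B | (T :: nat pair_pre_digraph) B. tree_decomposition G T B}"

end

theory Submission
  imports Defs
begin

text \<open>
  Take a tree decomposition of width at most \<open>t\<close> of the graph induced by \<open>S\<close> in which adjacent bags
  differ, so that every adhesion (the intersection of two adjacent bags) has at most \<open>t\<close> vertices.

  If some adhesion \<open>X\<close> leaves an edge on both sides, then each side consists of common non-neighbours
  of the edge on the other side. Hence \<open>S\<close> is determined by \<open>X\<close>, the two edges and one subset of each
  of two sets of size at most \<open>c - 1\<close>.

  Otherwise orient every tree edge away from a side on which removing the adhesion leaves no edge. A
  sink of this orientation has a bag \<open>X\<close> such that \<open>S - X\<close> is independent and each of its vertices
  has at most \<open>t\<close> neighbours in \<open>X\<close>. Conversely, every set of this shape has treewidth at most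
  \<open>t\<close>: use a star with centre \<open>X\<close>. So if \<open>S\<close> is maximal, \<open>S - X\<close> is a maximal independent set
  of a graph determined by \<open>X\<close>, and there are at most \<open>1 + n\<^sup>2 2\<^bsup>c-1\<^esup>\<close> of those.
\<close>

section \<open>Trees as connected relations in which every edge is a bridge\<close>

lemma rtrancl_crossing:
  assumes "(a, b) \<in> r\<^sup>*" "a \<in> A" "b \<notin> A"
  shows "\<exists>p q. (p, q) \<in> r \<and> p \<in> A \<and> q \<notin> A"
  using assms by (induction rule: rtrancl_induct) auto

text \<open>Acyclicity is encoded as "every edge is a bridge": in this form an edge cuts the tree
  into two sides, and the property survives contraction of an edge.\<close>

locale bridge_tree =
  fixes V :: "'n set" and E :: "'n rel"
  assumes finite_nodes: "finite V"
    and nodes_nonempty: "V \<noteq> {}"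
    and edges_in_nodes: "E \<subseteq> V \<times> V"
    and sym_edges: "sym E"
    and connected_nodes: "x \<in> V \<Longrightarrow> y \<in> V \<Longrightarrow> (x, y) \<in> E\<^sup>*"
    and bridge: "(x, y) \<in> E \<Longrightarrow> (x, y) \<notin> (E - {(x, y), (y, x)})\<^sup>*"
begin

definition side :: "'n \<Rightarrow> 'n \<Rightarrow> 'n set" where
  "side x y = {z. (x, z) \<in> (E - {(x, y), (y, x)})\<^sup>*}"

lemma self_in_side: "x \<in> side x y"
  by (simp add: side_def)

lemma not_in_side: "(x, y) \<in> E \<Longrightarrow> y \<notin> side x y"
  using bridge by (simp add: side_def)

lemma edge_sym: "(x, y) \<in> E \<Longrightarrow> (y, x) \<in> E"
  using sym_edges by (auto dest: symD)

lemma side_subset_nodes: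
  assumes "x \<in> V" shows "side x y \<subseteq> V"
proof
  fix z assume "z \<in> side x y"
  then have "(x, z) \<in> (E - {(x, y), (y, x)})\<^sup>*" by (simp add: side_def)
  then show "z \<in> V" using assms edges_in_nodes by (induction rule: rtrancl_induct) auto
qed

text \<open>Every edge other than xy survives the deletion and so prolongs a walk from x. The bridge
  property keeps y out of the side, so only the direction from x to y remains.\<close>

lemma edge_leaving_side:
  assumes "(x, y) \<in> E" "(a, b) \<in> E" "a \<in> side x y" "b \<notin> side x y"
  shows "a = x \<and> b = y"
proof (rule ccontr)
  assume *: "\<not> ?thesis"
  have "a \<noteq> y" using assms not_in_side by auto
  with * assms(2) have "(a, b) \<in> E - {(x, y), (y, x)}" by auto
  with assms(3) have "b \<in> side x y"
    unfolding side_def by (auto intro: rtrancl_into_rtrancl)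
  with assms(4) show False by simp
qed

lemma sides_cover:
  assumes "(x, y) \<in> E" shows "side x y \<union> side y x = V"
proof
  show "side x y \<union> side y x \<subseteq> V"
    using assms edges_in_nodes by (auto dest!: side_subset_nodes[THEN subsetD, rotated])
  show "V \<subseteq> side x y \<union> side y x"
  proof (rule ccontr)
    assume "\<not> V \<subseteq> side x y \<union> side y x"
    then obtain z where z: "z \<in> V" "z \<notin> side x y \<union> side y x" by auto
    have "x \<in> V" using assms edges_in_nodes by auto
    then obtain p q where pq: "(p, q) \<in> E" "p \<in> side x y \<union> side y x" "q \<notin> side x y \<union> side y x"
      using rtrancl_crossing[OF connected_nodes[of x z], of "side x y \<union> side y x"] z
        self_in_side[of x y] by auto
    then show False
      using edge_leaving_side[OF assms, of p q] edge_leaving_side[OF edge_sym[OF assms], of p q]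
        self_in_side[of x y] self_in_side[of y x] by auto
  qed
qed

lemma sides_disjoint:
  assumes "(x, y) \<in> E" shows "side x y \<inter> side y x = {}"
proof (rule ccontr)
  assume "side x y \<inter> side y x \<noteq> {}"
  then obtain a where a: "(x, a) \<in> (E - {(x, y), (y, x)})\<^sup>*" "(y, a) \<in> (E - {(x, y), (y, x)})\<^sup>*"
    by (auto simp: side_def insert_commute)
  have "sym (E - {(x, y), (y, x)})" using sym_edges by (auto simp: sym_def)
  then have "(a, y) \<in> (E - {(x, y), (y, x)})\<^sup>*" using a(2) sym_rtrancl symD by metis
  with a(1) have "(x, y) \<in> (E - {(x, y), (y, x)})\<^sup>*" by (rule rtrancl_trans)
  with bridge[OF assms] show False by simp
qed

text \<open>A walk witnessing membership in \<open>side x y\<close> never visits y, whereas y is the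
  only exit from \<open>side y z\<close>. The node y itself makes the inclusion strict.\<close>

lemma side_psubset_next_side:
  assumes "(x, y) \<in> E" "(y, z) \<in> E" "z \<noteq> x"
  shows "side x y \<subset> side y z"
proof -
  have "a \<in> side y z" if "a \<in> side x y" for a
  proof (rule ccontr)
    assume "a \<notin> side y z"
    moreover have x: "x \<in> side y z"
    proof (rule ccontr)
      assume "x \<notin> side y z"
      then show False
        using edge_leaving_side[OF assms(2) edge_sym[OF assms(1)] self_in_side] assms(3) by auto
    qed
    moreover from that have "(x, a) \<in> (E - {(x, y), (y, x)})\<^sup>*" by (simp add: side_def)
    ultimately have "(x, a) \<in> (E - {(x, y), (y, x)})\<^sup>*" "x \<in> side y z \<inter> side x y"
      "a \<notin> side y z \<inter> side x y" by (auto simp: self_in_side)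
    then obtain p q where pq: "(p, q) \<in> E - {(x, y), (y, x)}"
      "p \<in> side y z" "p \<in> side x y" "q \<notin> side y z \<inter> side x y"
      using rtrancl_crossing[of x a _ "side y z \<inter> side x y"] by blast
    then have "q \<in> side x y" using edge_leaving_side[OF assms(1), of p q] by blast
    then have "q \<notin> side y z" using pq by blast
    then have "p = y" using edge_leaving_side[OF assms(2), of p q] pq by blast
    then show False using pq not_in_side[OF assms(1)] by blast
  qed
  moreover have "y \<in> side y z" "y \<notin> side x y"
    using self_in_side not_in_side[OF assms(1)] by auto
  ultimately show ?thesis by blast
qed

text \<open>Follow a walk from x to z: a step out of x enters a branch, and a branch can be left
  only by returning to x.\<close>

lemma node_in_branch:
  assumes "x \<in> V" "z \<in> V" "z \<noteq> x"
  obtains y where "(x, y) \<in> E" "z \<in> side y x"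
proof -
  have "(x, z) \<in> E\<^sup>*" using assms connected_nodes by auto
  then have "z = x \<or> (\<exists>y. (x, y) \<in> E \<and> z \<in> side y x)"
  proof (induction rule: rtrancl_induct)
    case (step z w)
    show ?case
    proof (cases "z = x")
      case True
      then show ?thesis using step self_in_side by blast
    next
      case False
      then obtain y where "(x, y) \<in> E" "z \<in> side y x" using step by auto
      then show ?thesis using edge_leaving_side[of y x z w] step edge_sym by blast
    qed
  qed simp
  with assms that show thesis by auto
qed

text \<open>
  The head of a good edge whose tail side is largest is a sink, since an edge directed out of it
  would have a strictly larger tail side.
\<close>

lemma sink_exists:
  assumes "\<And>x y. (x, y) \<in> E \<Longrightarrow> good x y \<or> good y x"
  obtains x where "x \<in> V" "\<And>y. (x, y) \<in> E \<Longrightarrow> good y x"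
proof (cases "\<exists>x y. (x, y) \<in> E \<and> good x y")
  case False
  then have "(x, y) \<notin> E" for x y using assms edge_sym by blast
  with nodes_nonempty that show thesis by blast
next
  case True
  then obtain x0 y0 where start: "(x0, y0) \<in> E" "good x0 y0" by auto
  let ?P = "\<lambda>e. e \<in> E \<and> good (fst e) (snd e)"
  have "\<exists>e. ?P e \<and> (\<forall>e'. ?P e' \<longrightarrow> card (side (fst e') (snd e')) \<le> card (side (fst e) (snd e)))"
  proof (rule Lattices_Big.ex_has_greatest_nat)
    show "\<forall>e. ?P e \<longrightarrow> card (side (fst e) (snd e)) < Suc (card V)"
    proof (intro allI impI)
      fix e assume "?P e"
      then have "fst e \<in> V" using edges_in_nodes by (cases e) auto
      then show "card (side (fst e) (snd e)) < Suc (card V)"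
        using side_subset_nodes finite_nodes by (simp add: card_mono less_Suc_eq_le)
    qed
    show "?P (x0, y0)" using start by simp
  qed
  then obtain x y where xy: "(x, y) \<in> E" "good x y"
    and max: "\<And>x' y'. (x', y') \<in> E \<Longrightarrow> good x' y' \<Longrightarrow> card (side x' y') \<le> card (side x y)"
    by auto
  have y: "y \<in> V" using xy edges_in_nodes by auto
  have "good z y" if yz: "(y, z) \<in> E" for z
  proof (rule ccontr)
    assume *: "\<not> good z y"
    with xy have "z \<noteq> x" by auto
    have "good y z" using * assms[OF yz] by auto
    with max yz have "card (side y z) \<le> card (side x y)" by auto
    moreover have "card (side x y) < card (side y z)"
      using side_psubset_next_side[OF xy(1) yz \<open>z \<noteq> x\<close>] side_subset_nodes[OF y] finite_nodes
      by (meson finite_subset psubset_card_mono)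
    ultimately show False by simp
  qed
  with y that show thesis by blast
qed

text \<open>\<open>f\<close> merges y into x, and \<open>f a \<noteq> f b\<close> drops the
  resulting loop. A walk around an edge of the contracted tree would lift to a walk around its
  preimage.\<close>

lemma contract_edge:
  assumes xy: "(x, y) \<in> E" and f: "f = (\<lambda>z. if z = y then x else z)"
  shows "bridge_tree (V - {y}) {(f a, f b) |a b. (a, b) \<in> E \<and> f a \<noteq> f b}"
    (is "bridge_tree ?V ?E")
proof
  have "x \<noteq> y" using bridge[OF xy] by auto
  have "x \<in> V" "y \<in> V" using xy edges_in_nodes by auto
  then have fV: "z \<in> V \<Longrightarrow> f z \<in> ?V" for z using \<open>x \<noteq> y\<close> by (auto simp: f)
  show "finite ?V" using finite_nodes by simp
  show "?V \<noteq> {}" using \<open>x \<noteq> y\<close> \<open>x \<in> V\<close> by auto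
  show "?E \<subseteq> ?V \<times> ?V" using fV edges_in_nodes by blast
  show "sym ?E" using edge_sym by (auto simp: sym_def; metis)
  show "(p, q) \<in> ?E\<^sup>*" if "p \<in> ?V" "q \<in> ?V" for p q
  proof -
    have "(p, q) \<in> E\<^sup>*" using that connected_nodes by auto
    then have "(f p, f q) \<in> ?E\<^sup>*"
    proof (induction rule: rtrancl_induct)
      case (step b c)
      then have "f b = f c \<or> (f b, f c) \<in> ?E" by auto
      with step show ?case by (metis (no_types, lifting) rtrancl.simps)
    qed simp
    with that show ?thesis by (simp add: f)
  qed
  show "(p, q) \<notin> (?E - {(p, q), (q, p)})\<^sup>*" if "(p, q) \<in> ?E" for p q
  proof
    assume path: "(p, q) \<in> (?E - {(p, q), (q, p)})\<^sup>*"
    from that obtain a b where ab: "(a, b) \<in> E" "f a \<noteq> f b" "p = f a" "q = f b" by auto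
    let ?E0 = "E - {(a, b), (b, a)}"
    \<comment> \<open>Since \<open>f x = f y\<close>, the contracted edge differs from ab and can be
      used to pass between z and \<open>f z\<close>.\<close>
    have "(x, y) \<in> ?E0" "(y, x) \<in> ?E0" using ab xy edge_sym by (auto simp: f)
    then have lift: "(z, f z) \<in> ?E0\<^sup>*" "(f z, z) \<in> ?E0\<^sup>*" for z by (auto simp: f)
    have "(p, q) \<in> ?E0\<^sup>*" using path
    proof (induction rule: rtrancl_induct)
      case (step r s)
      then obtain c d where cd: "(c, d) \<in> E" "r = f c" "s = f d" by auto
      then have "(c, d) \<in> ?E0" using step ab by auto
      then have "(r, s) \<in> ?E0\<^sup>*" using lift[of c] lift[of d] cd
        by (meson r_into_rtrancl rtrancl_trans)
      with step show ?case by (meson rtrancl_trans)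
    qed simp
    then have "(a, b) \<in> ?E0\<^sup>*" using lift[of a] lift[of b] ab by (meson rtrancl_trans)
    with bridge[OF ab(1)] show False by simp
  qed
qed

end

section \<open>Decompositions over bridge trees\<close>

text \<open>\<open>R\<close> is the adjacency of an ambient graph; only its pairs inside
  \<open>S\<close> are constrained, so the induced subgraph on \<open>S\<close> is
  decomposed.\<close>

locale bridge_tree_decomposition = bridge_tree V E
  for V :: "'n set" and E :: "'n rel" +
  fixes Bg :: "'n \<Rightarrow> 'a set" and S :: "'a set" and R :: "'a rel"
  assumes bags_cover: "(\<Union>x \<in> V. Bg x) = S"
    and edge_in_bag: "(u, v) \<in> R \<Longrightarrow> u \<in> S \<Longrightarrow> v \<in> S \<Longrightarrow> \<exists>x \<in> V. u \<in> Bg x \<and> v \<in> Bg x"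
    and bags_connected: "x \<in> V \<Longrightarrow> y \<in> V \<Longrightarrow> v \<in> Bg x \<Longrightarrow> v \<in> Bg y \<Longrightarrow>
      (x, y) \<in> (E \<inter> {p. v \<in> Bg p} \<times> {p. v \<in> Bg p})\<^sup>*"
begin

definition part :: "'n \<Rightarrow> 'n \<Rightarrow> 'a set" where
  "part x y = (\<Union>z \<in> side x y. Bg z) - Bg x \<inter> Bg y"

text \<open>The nodes whose bags contain v are connected among themselves, and they can cross from
  one side to the other only along xy.\<close>

lemma bags_meet_in_adhesion:
  assumes "(x, y) \<in> E" "a \<in> side x y" "b \<in> side y x" "v \<in> Bg a" "v \<in> Bg b"
  shows "v \<in> Bg x \<inter> Bg y"
proof -
  have "a \<in> V" "b \<in> V" "b \<notin> side x y" using assms sides_cover sides_disjoint by blast+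
  then obtain p q where "(p, q) \<in> E" "v \<in> Bg p" "v \<in> Bg q" "p \<in> side x y" "q \<notin> side x y"
    using rtrancl_crossing[OF bags_connected[of a b v] assms(2)] assms by auto
  with edge_leaving_side[OF assms(1), of p q] show ?thesis by blast
qed

lemma parts_disjoint: "(x, y) \<in> E \<Longrightarrow> part x y \<inter> part y x = {}"
  using bags_meet_in_adhesion unfolding part_def by blast

lemma parts_cover:
  assumes "(x, y) \<in> E" shows "S = Bg x \<inter> Bg y \<union> part x y \<union> part y x"
proof -
  have "x \<in> V" "y \<in> V" using assms edges_in_nodes by auto
  then show ?thesis
    unfolding part_def bags_cover[symmetric] sides_cover[OF assms, symmetric] by blast
qed

text \<open>A bag holding both ends lies on one side of xy; the end from the other part would then
  lie in the adhesion, which \<open>part\<close> excludes.\<close>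

lemma no_edge_between_parts:
  assumes "(x, y) \<in> E" "u \<in> part x y" "v \<in> part y x" shows "(u, v) \<notin> R"
proof
  assume "(u, v) \<in> R"
  then obtain z where "z \<in> V" "u \<in> Bg z" "v \<in> Bg z"
    using edge_in_bag assms parts_cover by blast
  with assms bags_meet_in_adhesion[OF assms(1)] sides_cover[OF assms(1)] show False
    unfolding part_def by blast
qed

end

section \<open>Two shapes of vertex sets of small treewidth\<close>

definition indep :: "'a rel \<Rightarrow> 'a set \<Rightarrow> bool" where
  "indep R I \<longleftrightarrow> (\<forall>u \<in> I. \<forall>v \<in> I. (u, v) \<notin> R)"

text \<open>The tree is forgotten: only a separation of order at most t with an edge on each side is
  kept for the count.\<close>

definition split_with_edges :: "'a rel \<Rightarrow> nat \<Rightarrow> 'a set \<Rightarrow> bool" where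
  "split_with_edges R t S \<longleftrightarrow>
     (\<exists>X A A'. S = X \<union> A \<union> A' \<and> card X \<le> t \<and> A \<inter> A' = {} \<and>
        \<not> indep R A \<and> \<not> indep R A' \<and> (\<forall>u \<in> A. \<forall>v \<in> A'. (u, v) \<notin> R))"

text \<open>These are the conditions for a star decomposition with centre bag X: a leaf bag is w
  with its neighbours in X, so t neighbours keep it within t + 1.\<close>

definition indep_outside_core :: "'a rel \<Rightarrow> nat \<Rightarrow> 'a set \<Rightarrow> 'a set \<Rightarrow> bool" where
  "indep_outside_core R t X S \<longleftrightarrow>
     X \<subseteq> S \<and> card X \<le> Suc t \<and> indep R (S - X) \<and> (\<forall>w \<in> S - X. card {x \<in> X. (w, x) \<in> R} \<le> t)"

context bridge_tree_decomposition
begin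

lemma sink_bag:
  assumes "finite S" and width: "\<And>x. x \<in> V \<Longrightarrow> card (Bg x) \<le> Suc t"
    and adhesion: "\<And>x y. (x, y) \<in> E \<Longrightarrow> card (Bg x \<inter> Bg y) \<le> t"
    and "\<not> split_with_edges R t S"
  shows "\<exists>X. indep_outside_core R t X S"
proof -
  have "indep R (part x y) \<or> indep R (part y x)" if "(x, y) \<in> E" for x y
    using assms(4) parts_cover[OF that] adhesion[OF that] parts_disjoint[OF that]
      no_edge_between_parts[OF that] unfolding split_with_edges_def by blast
  \<comment> \<open>Each tree edge points away from an independent part, so at a sink x the part
    behind every neighbouring node is independent.\<close>
  then obtain x where x: "x \<in> V" and sink: "\<And>y. (x, y) \<in> E \<Longrightarrow> indep R (part y x)"
    using sink_exists[of "\<lambda>x y. indep R (part x y)"] by blast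
  have sub: "Bg x \<subseteq> S" using x bags_cover by blast
  have "indep R (S - Bg x)"
    unfolding indep_def
  proof (intro ballI notI)
    fix u v assume uv: "u \<in> S - Bg x" "v \<in> S - Bg x" "(u, v) \<in> R"
    then obtain z where z: "z \<in> V" "u \<in> Bg z" "v \<in> Bg z" using edge_in_bag by blast
    with uv have "z \<noteq> x" by auto
    then obtain y where y: "(x, y) \<in> E" "z \<in> side y x" using node_in_branch x z(1) by metis
    then have "u \<in> part y x" "v \<in> part y x" using uv z unfolding part_def by auto
    with sink[OF y(1)] uv show False unfolding indep_def by blast
  qed
  moreover have "card {b \<in> Bg x. (w, b) \<in> R} \<le> t" if w: "w \<in> S - Bg x" for w
  proof -
    from w obtain z where z: "z \<in> V" "w \<in> Bg z" using bags_cover by blast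
    with w have "z \<noteq> x" by auto
    then obtain y where y: "(x, y) \<in> E" "z \<in> side y x" using node_in_branch x z(1) by metis
    then have w': "w \<in> part y x" using w z unfolding part_def by auto
    \<comment> \<open>w lies behind y, so a neighbour of w in the bag at x must lie in the adhesion
      with y; otherwise the separation would cut it off from w.\<close>
    have "b \<in> Bg y" if b: "b \<in> Bg x" "(w, b) \<in> R" for b
    proof (rule ccontr)
      assume "b \<notin> Bg y"
      then have "b \<in> part x y" using b self_in_side unfolding part_def by blast
      with no_edge_between_parts[OF edge_sym[OF y(1)] w'] b show False by blast
    qed
    then have "{b \<in> Bg x. (w, b) \<in> R} \<subseteq> Bg x \<inter> Bg y" by blast
    moreover have "finite (Bg x)" using sub assms(1) finite_subset by blast
    ultimately show ?thesis using adhesion[OF y(1)] card_mono[of "Bg x \<inter> Bg y"]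
      by (meson finite_Int order_trans)
  qed
  ultimately show ?thesis using width[OF x] sub unfolding indep_outside_core_def by blast
qed

lemma contract_equal_bags:
  assumes xy: "(x, y) \<in> E" and f: "f = (\<lambda>z. if z = y then x else z)" and eq: "Bg x = Bg y"
  shows "bridge_tree_decomposition (V - {y}) {(f a, f b) |a b. (a, b) \<in> E \<and> f a \<noteq> f b} Bg S R"
    (is "bridge_tree_decomposition ?V ?E Bg S R")
proof -
  interpret c: bridge_tree ?V ?E by (rule contract_edge[OF xy f])
  have "x \<noteq> y" using bridge[OF xy] by auto
  have "x \<in> V" "y \<in> V" using xy edges_in_nodes by auto
  then have fV: "z \<in> V \<Longrightarrow> f z \<in> ?V" for z using \<open>x \<noteq> y\<close> by (auto simp: f)
  have Bf: "Bg (f z) = Bg z" for z using eq by (simp add: f)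
  show ?thesis
  proof
    show "(\<Union>x \<in> ?V. Bg x) = S"
    proof
      show "(\<Union>x \<in> ?V. Bg x) \<subseteq> S" using bags_cover by blast
      show "S \<subseteq> (\<Union>x \<in> ?V. Bg x)" using bags_cover fV Bf by blast
    qed
    show "\<exists>x \<in> ?V. u \<in> Bg x \<and> v \<in> Bg x" if "(u, v) \<in> R" "u \<in> S" "v \<in> S" for u v
      using edge_in_bag[OF that] fV Bf by metis
    show "(p, q) \<in> (?E \<inter> {p. v \<in> Bg p} \<times> {p. v \<in> Bg p})\<^sup>*" (is "_ \<in> ?Ev\<^sup>*")
      if "p \<in> ?V" "q \<in> ?V" "v \<in> Bg p" "v \<in> Bg q" for p q v
    proof -
      have "(p, q) \<in> (E \<inter> {p. v \<in> Bg p} \<times> {p. v \<in> Bg p})\<^sup>*"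
        using that by (intro bags_connected) auto
      then have "(f p, f q) \<in> ?Ev\<^sup>*"
      proof (induction rule: rtrancl_induct)
        case (step b c)
        then have "f b = f c \<or> (f b, f c) \<in> ?Ev" using Bf by auto
        with step.IH show ?case by (metis (no_types, lifting) rtrancl.simps)
      qed simp
      with that show ?thesis by (simp add: f)
    qed
  qed
qed

end

text \<open>Tree edges with equal bags are contracted, by induction on the number of nodes, until
  adjacent bags differ and \<open>sink_bag\<close> applies.\<close>

lemma split_or_core_of_bridge_tree_decomposition:
  assumes "bridge_tree_decomposition V E Bg S R" and "finite S"
    and "\<And>x. x \<in> V \<Longrightarrow> card (Bg x) \<le> Suc t"
  shows "split_with_edges R t S \<or> (\<exists>X. indep_outside_core R t X S)"
  using assms
proof (induction "card V" arbitrary: V E rule: less_induct)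
  case less
  interpret bridge_tree_decomposition V E Bg S R by (rule less.prems)
  show ?case
  proof (cases "\<exists>x y. (x, y) \<in> E \<and> Bg x = Bg y")
    case True
    then obtain x y where xy: "(x, y) \<in> E" "Bg x = Bg y" by auto
    then have "y \<in> V" using edges_in_nodes by auto
    then have "card (V - {y}) < card V" using finite_nodes by (meson card_Diff1_less)
    from less.hyps[OF this contract_equal_bags[OF xy(1) refl xy(2)]] less.prems show ?thesis
      by blast
  next
    case False
    have "card (Bg x \<inter> Bg y) \<le> t" if "(x, y) \<in> E" for x y
    proof (rule ccontr)
      assume *: "\<not> card (Bg x \<inter> Bg y) \<le> t"
      have V: "x \<in> V" "y \<in> V" using that edges_in_nodes by auto
      then have "finite (Bg x)" "finite (Bg y)"
        using bags_cover less.prems(2) by (meson UN_upper finite_subset subset_refl)+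
      \<comment> \<open>An intersection with more than t elements exhausts both bags, as neither has
        more than t + 1.\<close>
      then have "Bg x \<inter> Bg y = Bg x" "Bg x \<inter> Bg y = Bg y"
        using * less.prems(3)[OF V(1)] less.prems(3)[OF V(2)]
        by (intro card_seteq; simp)+
      with False that show False by auto
    qed
    with sink_bag less.prems show ?thesis by blast
  qed
qed

section \<open>Treewidth\<close>

lemma rtrancl_on_imp_rtrancl_Restr:
  "(a, b) \<in> rtrancl_on F r \<Longrightarrow> (a, b) \<in> (Restr r F)\<^sup>*"
  by (induction rule: rtrancl_on_induct) (auto intro: rtrancl_into_rtrancl)

lemma arcs_ends_induce_with_proj:
  "arcs_ends (with_proj G \<restriction> W) = Restr (parcs G) W"
  by (auto simp: arcs_ends_conv induce_subgraph_def)

text \<open>A walk around a tree edge could be shortened to a path and closed by the reverse arc to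
  a directed cycle of length at least 3.\<close>

lemma bridge_tree_of_undirected_tree:
  assumes "undirected_tree T" shows "bridge_tree (pverts T) (parcs T)"
proof -
  interpret T: pair_graph T using assms by (simp add: undirected_tree_def)
  have sym: "sym (parcs T)" using T.pair_sym_arcs by (simp add: symmetric_def)
  then have symcl: "(parcs T)\<^sup>s = parcs T" by (auto simp: symcl_def sym_def)
  have conn: "connected (with_proj T)"
    and acyclic: "\<And>p. pre_digraph.cycle (with_proj T) p \<Longrightarrow> \<not> 3 \<le> length p"
    using assms by (auto simp: undirected_tree_def)
  have edges: "parcs T \<subseteq> pverts T \<times> pverts T" by (auto dest: T.in_arcsD1 T.in_arcsD2)
  show ?thesis
  proof
    show "finite (pverts T)" by (rule T.pair_finite_verts)
    show "pverts T \<noteq> {}" using conn by (simp add: connected_conv)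
    show "sym (parcs T)" "parcs T \<subseteq> pverts T \<times> pverts T" by (fact sym, fact edges)
    show "(x, y) \<in> (parcs T)\<^sup>*" if "x \<in> pverts T" "y \<in> pverts T" for x y
    proof -
      have "(x, y) \<in> rtrancl_on (pverts T) (parcs T)"
        using conn that unfolding connected_conv by (simp add: symcl)
      then show ?thesis by (rule rtrancl_on_rtranclI)
    qed
    show "(x, y) \<notin> (parcs T - {(x, y), (y, x)})\<^sup>*" if xy: "(x, y) \<in> parcs T" for x y
    proof
      assume path: "(x, y) \<in> (parcs T - {(x, y), (y, x)})\<^sup>*"
      define T0 where "T0 = \<lparr>pverts = pverts T, parcs = parcs T - {(x, y), (y, x)}\<rparr>"
      interpret T0: pair_wf_digraph T0
        by unfold_locales (auto simp: T0_def dest: T.in_arcsD1 T.in_arcsD2)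
      have V: "x \<in> pverts T" "y \<in> pverts T" using xy edges by auto
      have "x \<rightarrow>\<^sup>*\<^bsub>with_proj T0\<^esub> y" using path
      proof (induction rule: rtrancl_induct)
        case base
        then show ?case using V T0.reachable_refl[of x] by (simp add: T0_def)
      next
        case (step a b)
        then have "(a, b) \<in> parcs T0" by (simp add: T0_def)
        with step.IH show ?case using T0.reachable_adj_trans by simp
      qed
      then obtain p where "T0.apath x p y" using T0.reachable_apath by blast
      then have p: "set p \<subseteq> parcs T - {(x, y), (y, x)}" "pcas x p y" "distinct (pawalk_verts x p)"
        unfolding T0.apath_def T0.awalk_def by (auto simp: T0_def)
      have "x \<noteq> y" using xy T.pair_no_loops by force
      \<comment> \<open>Length 0 would force x = y, and length 1 would use a deleted arc.\<close>
      with p have "2 \<le> length p"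
        by (cases p rule: list.exhaust[case_product list.exhaust[of "tl p"]]) auto
      moreover have "T.cycle ((y, x) # p)"
        unfolding T.cycle_def using p V xy sym
        by (intro exI[of _ y]) (auto simp: T.awalk_def dest: symD)
      ultimately show False using acyclic by fastforce
    qed
  qed
qed

lemma bridge_tree_decomposition_of_tree_decomposition:
  assumes "tree_decomposition (with_proj G \<restriction> S) T B"
  shows "bridge_tree_decomposition (pverts T) (parcs T) B S (parcs G)"
proof -
  have T: "undirected_tree T" using assms by (simp add: tree_decomposition_def)
  interpret bridge_tree "pverts T" "parcs T" by (rule bridge_tree_of_undirected_tree[OF T])
  show ?thesis
  proof
    show cover: "(\<Union>x \<in> pverts T. B x) = S"
      using assms by (simp add: tree_decomposition_def)
    show "\<exists>x \<in> pverts T. u \<in> B x \<and> v \<in> B x" if "(u, v) \<in> parcs G" "u \<in> S" "v \<in> S" for u v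
      using assms that unfolding tree_decomposition_def by (auto simp: arcs_ends_induce_with_proj)
    show "(x, y) \<in> (parcs T \<inter> {p. v \<in> B p} \<times> {p. v \<in> B p})\<^sup>*"
      if "x \<in> pverts T" "y \<in> pverts T" "v \<in> B x" "v \<in> B y" for x y v
    proof -
      let ?W = "{x \<in> pverts T. v \<in> B x}"
      have "v \<in> S" using cover that by blast
      then have "connected (with_proj T \<restriction> ?W)"
        using assms unfolding tree_decomposition_def by simp
      then have "(x, y) \<in> rtrancl_on ?W ((Restr (parcs T) ?W)\<^sup>s)"
        using that unfolding connected_conv by (simp add: arcs_ends_induce_with_proj)
      moreover have "(Restr (parcs T) ?W)\<^sup>s = Restr (parcs T) ?W"
        using sym_edges by (auto simp: symcl_def sym_def)
      ultimately have "(x, y) \<in> rtrancl_on ?W (Restr (parcs T) ?W)" by (simp only:)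
      then have "(x, y) \<in> (Restr (Restr (parcs T) ?W) ?W)\<^sup>*"
        by (rule rtrancl_on_imp_rtrancl_Restr)
      then show ?thesis by (rule rtrancl_mono[THEN subsetD, rotated]) auto
    qed
  qed
qed

section \<open>Stars and the decompositions they carry\<close>

definition star :: "nat \<Rightarrow> nat pair_pre_digraph" where
  "star m = \<lparr>pverts = {0..m}, parcs = {0} \<times> {1..m} \<union> {1..m} \<times> {0}\<rparr>"

lemma connected_star_induce:
  assumes "0 \<in> W" "W \<subseteq> {0..m}" shows "connected (with_proj (star m) \<restriction> W)"
proof -
  let ?r = "(Restr (parcs (star m)) W)\<^sup>s"
  have "(u, 0) \<in> rtrancl_on W ?r \<and> (0, u) \<in> rtrancl_on W ?r" if "u \<in> W" for u
  proof (cases "u = 0")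
    case False
    then have "(u, 0) \<in> ?r" "(0, u) \<in> ?r" using that assms by (auto simp: symcl_def star_def)
    then show ?thesis using that assms by (meson rtrancl_on_into_rtrancl_on rtrancl_on_refl)
  qed (use assms in simp)
  then have "\<forall>u\<in>W. \<forall>v\<in>W. (u, v) \<in> rtrancl_on W ?r" by (meson rtrancl_on_trans)
  then show ?thesis unfolding connected_conv arcs_ends_induce_with_proj using assms by auto
qed

lemma undirected_tree_star: "undirected_tree (star m)"
proof -
  interpret pair_graph "star m"
    by unfold_locales (auto simp: star_def symmetric_def sym_def)
  have "with_proj (star m) \<restriction> {0..m} = with_proj (star m)"
    by (auto simp: induce_subgraph_def with_proj_def star_def)
  then have "connected (with_proj (star m))" using connected_star_induce[of "{0..m}" m] by simp
  moreover have False if cyc: "cycle p" and len: "3 \<le> length p" for p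
  proof -
    obtain e1 e2 e3 es where p: "p = e1 # e2 # e3 # es"
      using len by (metis (no_types, lifting) Suc_le_length_iff numeral_3_eq_3)
    obtain u where u: "set p \<subseteq> parcs (star m)" "pcas u p u" "distinct (tl (pawalk_verts u p))"
      using cyc unfolding cycle_def awalk_def by auto
    have last: "u \<in> set (pawalk_verts (snd e3) es)"
    proof -
      have "pcas a q b \<Longrightarrow> b \<in> set (pawalk_verts a q)" for a b :: nat and q
        by (induction q arbitrary: a) auto
      then show ?thesis using u p by auto
    qed
    have hub: "fst e = 0 \<longleftrightarrow> snd e \<noteq> 0" if "e \<in> set p" for e
      using that u(1) by (auto simp: star_def)
    have hd: "snd e3 \<in> set (pawalk_verts (snd e3) es)" using u(2) p by (cases es) auto
    \<comment> \<open>Hub and leaves alternate, so the hub is the first and third or the second and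
      fourth vertex. Either repetition violates distinctness, since the first vertex recurs after
      the third.\<close>
    show False using u(2,3) hub[of e1] hub[of e2] hub[of e3] last hd p by auto
  qed
  ultimately show ?thesis unfolding undirected_tree_def using pair_graph_axioms by blast
qed

text \<open>A leaf bag is a vertex outside X with its neighbours in X. Independence puts every edge
  into some bag, and a vertex outside X lies in exactly one.\<close>

lemma star_decomposition:
  assumes "pair_graph G" "finite S" "X \<subseteq> S" "card X \<le> Suc t" "indep (parcs G) (S - X)"
    and nbrs: "\<And>w. w \<in> S - X \<Longrightarrow> card {x \<in> X. (w, x) \<in> parcs G} \<le> t"
  shows "\<exists>(T :: nat pair_pre_digraph) B. tree_decomposition (with_proj G \<restriction> S) T B \<and>
    (\<forall>x \<in> pverts T. card (B x) \<le> Suc t)"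
proof -
  interpret pair_graph G by fact
  have sym: "sym (parcs G)" using pair_sym_arcs by (simp add: symmetric_def)
  have fin: "finite X" "finite (S - X)" using assms finite_subset by auto
  \<comment> \<open>One leaf per vertex of \<open>S - X\<close>; if \<open>S = X\<close>, the star
    is the single node 0.\<close>
  define m where "m = card (S - X)"
  obtain h where h: "bij_betw h {1..m} (S - X)"
    using ex_bij_betw_nat_finite_1[OF fin(2)] m_def by auto
  define B where "B i = (if i = 0 then X else insert (h i) {x \<in> X. (h i, x) \<in> parcs G})" for i
  have h_in: "h i \<in> S - X" if "i \<in> {1..m}" for i using h that by (auto simp: bij_betw_def)
  have h_surj: "\<exists>i \<in> {1..m}. h i = w" if "w \<in> S - X" for w
    using h that by (metis bij_betw_iff_bijections)
  have cover: "(\<Union>i \<in> {0..m}. B i) = S"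
  proof
    have "B i \<subseteq> S" if "i \<in> {0..m}" for i using h_in[of i] \<open>X \<subseteq> S\<close> that by (auto simp: B_def)
    then show "(\<Union>i \<in> {0..m}. B i) \<subseteq> S" by blast
    show "S \<subseteq> (\<Union>i \<in> {0..m}. B i)"
    proof
      fix w assume "w \<in> S"
      show "w \<in> (\<Union>i \<in> {0..m}. B i)"
      proof (cases "w \<in> X")
        case False
        then obtain i where "i \<in> {1..m}" "h i = w" using h_surj \<open>w \<in> S\<close> by blast
        then show ?thesis by (intro UN_I[of i]) (auto simp: B_def)
      qed (auto simp: B_def)
    qed
  qed
  have edge: "\<exists>i \<in> {0..m}. u \<in> B i \<and> v \<in> B i" if uv: "(u, v) \<in> parcs G" "u \<in> S" "v \<in> S" for u v
  proof -
    have vu: "(v, u) \<in> parcs G" using sym uv by (auto dest: symD)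
    consider "u \<in> X" "v \<in> X" | "u \<in> S - X" "v \<in> X" | "u \<in> X" "v \<in> S - X"
      using uv assms(5) unfolding indep_def by blast
    then show ?thesis
    proof cases
      case 1
      then show ?thesis by (intro bexI[of _ 0]) (auto simp: B_def)
    next
      case 2
      then obtain i where "i \<in> {1..m}" "h i = u" using h_surj by blast
      with 2 uv show ?thesis by (intro bexI[of _ i]) (auto simp: B_def)
    next
      case 3
      then obtain i where "i \<in> {1..m}" "h i = v" using h_surj by blast
      with 3 vu show ?thesis by (intro bexI[of _ i]) (auto simp: B_def)
    qed
  qed
  have conn: "connected (with_proj (star m) \<restriction> {i \<in> {0..m}. v \<in> B i})" if "v \<in> S" for v
  proof (cases "v \<in> X")
    case True
    then show ?thesis by (intro connected_star_induce) (auto simp: B_def)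
  next
    case False
    then obtain i where i: "i \<in> {1..m}" "h i = v" using h_surj \<open>v \<in> S\<close> by blast
    have "j = i" if "j \<in> {0..m}" "v \<in> B j" for j
    proof -
      have "j \<in> {1..m}" "h j = v" using that False by (auto simp: B_def split: if_splits)
      with i h show ?thesis by (metis bij_betw_imp_inj_on inj_onD)
    qed
    moreover have "i \<in> {0..m}" "v \<in> B i" using i by (auto simp: B_def)
    ultimately have "{i \<in> {0..m}. v \<in> B i} = {i}" by blast
    then show ?thesis by (simp add: connected_conv)
  qed
  have "tree_decomposition (with_proj G \<restriction> S) (star m) B"
    unfolding tree_decomposition_def
  proof (intro conjI)
    have V: "pverts (star m) = {0..m}" by (simp add: star_def)
    show "undirected_tree (star m)" by (rule undirected_tree_star)
    show "(\<Union>i \<in> pverts (star m). B i) = verts (with_proj G \<restriction> S)" using cover V by simp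
    show "\<forall>u v. u \<rightarrow>\<^bsub>with_proj G \<restriction> S\<^esub> v \<longrightarrow> (\<exists>i \<in> pverts (star m). u \<in> B i \<and> v \<in> B i)"
      using edge V by (simp add: arcs_ends_induce_with_proj)
    show "\<forall>v \<in> verts (with_proj G \<restriction> S). connected (with_proj (star m) \<restriction> {i \<in> pverts (star m). v \<in> B i})"
      using conn V by simp
  qed
  moreover have "card (B i) \<le> Suc t" if "i \<in> {0..m}" for i
  proof (cases "i = 0")
    case False
    then have "card {x \<in> X. (h i, x) \<in> parcs G} \<le> t" using nbrs h_in that by auto
    moreover have "card (B i) \<le> Suc (card {x \<in> X. (h i, x) \<in> parcs G})"
      using False fin by (simp add: B_def card_insert_if)
    ultimately show ?thesis by simp
  qed (use assms in \<open>simp add: B_def\<close>)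
  ultimately show ?thesis by (intro exI[of _ "star m"] exI[of _ B]) (simp add: star_def)
qed

section \<open>Treewidth bounds as existence of decompositions\<close>

lemma decomposition_width_le_iff:
  assumes "undirected_tree T"
  shows "decomposition_width T B \<le> k \<longleftrightarrow> (\<forall>x \<in> pverts T. int (card (B x)) \<le> k + 1)"
proof -
  interpret bridge_tree "pverts T" "parcs T" by (rule bridge_tree_of_undirected_tree[OF assms])
  have "decomposition_width T B \<le> k \<longleftrightarrow> Max ((\<lambda>x. int (card (B x))) ` pverts T) \<le> k + 1"
    by (auto simp: decomposition_width_def)
  also have "\<dots> \<longleftrightarrow> (\<forall>x \<in> pverts T. int (card (B x)) \<le> k + 1)"
    using finite_nodes nodes_nonempty by (subst Max_le_iff) auto
  finally show ?thesis .
qed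

lemma treewidth_le_iff:
  fixes G :: "'a pair_pre_digraph"
  assumes "pair_graph G" "finite S"
  shows "treewidth (with_proj G \<restriction> S) \<le> int t \<longleftrightarrow>
    (\<exists>(T :: nat pair_pre_digraph) B. tree_decomposition (with_proj G \<restriction> S) T B \<and>
      (\<forall>x \<in> pverts T. card (B x) \<le> Suc t))" (is "_ \<longleftrightarrow> ?R")
proof -
  let ?D = "{decomposition_width T B | (T :: nat pair_pre_digraph) B.
    tree_decomposition (with_proj G \<restriction> S) T B}"
  have width: "decomposition_width T B \<le> int k \<longleftrightarrow> (\<forall>x \<in> pverts T. card (B x) \<le> Suc k)"
    if "tree_decomposition (with_proj G \<restriction> S) T B" for T :: "nat pair_pre_digraph" and B k
  proof -
    have "int a \<le> int k + 1 \<longleftrightarrow> a \<le> Suc k" for a by linarith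
    then show ?thesis
      using decomposition_width_le_iff[of T B "int k"] that by (simp add: tree_decomposition_def)
  qed
  have "bdd_below ?D"
  proof (rule bdd_belowI)
    fix d assume "d \<in> ?D"
    then obtain T :: "nat pair_pre_digraph" and B :: "nat \<Rightarrow> 'a set"
      where d: "d = decomposition_width T B"
      "undirected_tree T" by (auto simp: tree_decomposition_def)
    interpret bridge_tree "pverts T" "parcs T" by (rule bridge_tree_of_undirected_tree[OF d(2)])
    show "- 1 \<le> d"
    proof (rule ccontr)
      assume "\<not> - 1 \<le> d"
      then have "\<forall>x \<in> pverts T. int (card (B x)) \<le> - 2 + 1"
        using decomposition_width_le_iff[OF d(2), of B "- 2"] d(1) by simp
      with nodes_nonempty show False by auto
    qed
  qed
  \<comment> \<open>Taking the core to be all of S gives the decomposition with a single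
    bag.\<close>
  moreover have "?D \<noteq> {}"
    using star_decomposition[OF assms, of S "card S"] by (auto simp: indep_def)
  \<comment> \<open>Only a strict bound on the infimum directly yields an element below it; over the
    integers, being below t + 1 is the bound t.\<close>
  ultimately have "Inf ?D < int t + 1 \<longleftrightarrow> (\<exists>d \<in> ?D. d < int t + 1)"
    by (intro cInf_less_iff)
  also have "\<dots> \<longleftrightarrow> (\<exists>d \<in> ?D. d \<le> int t)" by (simp only: zless_add1_eq le_less)
  also have "\<dots> \<longleftrightarrow> ?R" using width by (simp only: mem_Collect_eq Bex_def) metis
  finally show ?thesis unfolding treewidth_def by (simp only: zless_add1_eq le_less)
qed

lemma treewidth_le_imp_split_or_core:
  assumes "pair_graph G" "finite S" "treewidth (with_proj G \<restriction> S) \<le> int t"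
  shows "split_with_edges (parcs G) t S \<or> (\<exists>X. indep_outside_core (parcs G) t X S)"
proof -
  obtain T :: "nat pair_pre_digraph" and B where
    "tree_decomposition (with_proj G \<restriction> S) T B" "\<forall>x \<in> pverts T. card (B x) \<le> Suc t"
    using assms treewidth_le_iff by blast
  then show ?thesis
    using split_or_core_of_bridge_tree_decomposition
      bridge_tree_decomposition_of_tree_decomposition assms(2) by metis
qed

lemma core_imp_treewidth_le:
  assumes "pair_graph G" "finite S" "indep_outside_core (parcs G) t X S"
  shows "treewidth (with_proj G \<restriction> S) \<le> int t"
  unfolding treewidth_le_iff[OF assms(1,2)]
  using assms by (intro star_decomposition[where X = X]) (auto simp: indep_outside_core_def)

section \<open>Counting\<close>

definition common_nonneighbours :: "'a rel \<Rightarrow> 'a set \<Rightarrow> 'a \<Rightarrow> 'a \<Rightarrow> 'a set" where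
  "common_nonneighbours R V u v = {w \<in> V. w \<noteq> u \<and> w \<noteq> v \<and> (u, w) \<notin> R \<and> (v, w) \<notin> R}"

text \<open>Testing single vertices suffices for inclusion-maximality because subsets of independent
  sets are independent.\<close>

definition max_indep :: "'a rel \<Rightarrow> 'a set \<Rightarrow> 'a set \<Rightarrow> bool" where
  "max_indep R W I \<longleftrightarrow> I \<subseteq> W \<and> indep R I \<and> (\<forall>w \<in> W - I. \<not> indep R (insert w I))"

lemma card_UN_le_mult:
  assumes "finite I" "card I \<le> a" "\<And>i. i \<in> I \<Longrightarrow> card (A i) \<le> b"
  shows "card (\<Union>i \<in> I. A i) \<le> a * b"
proof -
  have "card (\<Union>i \<in> I. A i) \<le> (\<Sum>i \<in> I. card (A i))" using assms(1) by (rule card_UN_le)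
  also have "\<dots> \<le> card I * b" using sum_bounded_above[of I "\<lambda>i. card (A i)" b] assms(3) by simp
  also have "\<dots> \<le> a * b" using assms(2) by simp
  finally show ?thesis .
qed

text \<open>
  Deleting a vertex \<open>v\<close> keeps a maximal independent set \<open>K\<close> maximal unless some neighbour \<open>u\<close> of
  \<open>v\<close> can take its place, and then \<open>K - {v}\<close> lies in the common non-neighbourhood of \<open>u\<close> and \<open>v\<close>.
\<close>

lemma card_max_indep_le:
  fixes V :: "'a set"
  assumes "finite V" "W \<subseteq> V" "sym R" "irrefl R"
    and few: "\<And>u v. (u, v) \<in> R \<Longrightarrow> u \<in> V \<Longrightarrow> v \<in> V \<Longrightarrow> card (common_nonneighbours R V u v) \<le> k"
  shows "card {I. max_indep R W I} \<le> 1 + (card W)\<^sup>2 * 2 ^ k"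
proof -
  have "finite W" using assms finite_subset by blast
  then show ?thesis using \<open>W \<subseteq> V\<close>
  proof (induction W rule: finite_induct)
    case empty
    have "{I. max_indep R {} I} \<subseteq> {{}}" by (auto simp: max_indep_def)
    then have "card {I. max_indep R {} I} \<le> card {{} :: 'a set}" by (intro card_mono) auto
    then show ?case by simp
  next
    case (insert v W)
    let ?M = "\<lambda>W. {I. max_indep R W I}"
    let ?U = "{u \<in> W. (u, v) \<in> R}"
    let ?A = "{K \<in> ?M (insert v W). K - {v} \<in> ?M W}"
    let ?B = "\<Union>u \<in> ?U. insert v ` Pow (common_nonneighbours R V u v)"
    have fin: "finite (common_nonneighbours R V u w)" for u w
      using \<open>finite V\<close> by (simp add: common_nonneighbours_def)
    have finM: "finite (?M W)"
      by (rule finite_subset[of _ "Pow W"]) (auto simp: max_indep_def insert)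
    have "?M (insert v W) \<subseteq> ?A \<union> ?B"
    proof (intro subsetI)
      fix K assume K: "K \<in> ?M (insert v W)"
      show "K \<in> ?A \<union> ?B"
      proof (cases "K - {v} \<in> ?M W")
        case False
        have Kind: "indep R K" and sub: "K \<subseteq> insert v W" using K by (auto simp: max_indep_def)
        then have "K - {v} \<subseteq> W" "indep R (K - {v})" by (auto simp: indep_def)
        with False obtain u where u: "u \<in> W" "u \<notin> K - {v}" "indep R (insert u (K - {v}))"
          by (auto simp: max_indep_def)
        then have "u \<noteq> v" "u \<notin> K" using insert by auto
        then have "\<not> indep R (insert u K)" using K u by (auto simp: max_indep_def)
        then have v: "v \<in> K" "(u, v) \<in> R"
          using u(3) Kind \<open>sym R\<close> \<open>irrefl R\<close>
          unfolding indep_def sym_def irrefl_def by (metis Diff_iff insert_iff empty_iff)+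
        have "K - {v} \<subseteq> common_nonneighbours R V u v"
        proof
          fix w assume w: "w \<in> K - {v}"
          then have "w \<in> V" "w \<noteq> u" using sub insert.prems \<open>u \<notin> K\<close> by auto
          moreover have "(u, w) \<notin> R" "(v, w) \<notin> R"
            using u(3) Kind v w unfolding indep_def by auto
          ultimately show "w \<in> common_nonneighbours R V u v"
            using w by (simp add: common_nonneighbours_def)
        qed
        moreover have "K = insert v (K - {v})" using v by auto
        ultimately show ?thesis using u v by blast
      qed (use K in simp)
    qed
    then have "card (?M (insert v W)) \<le> card (?A \<union> ?B)"
      by (rule card_mono[rotated])
        (use insert fin in \<open>auto intro: finite_subset[of _ "Pow (insert v W)"] simp: max_indep_def\<close>)
    also have "\<dots> \<le> card ?A + card ?B" by (rule card_Un_le)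
    also have "card ?A \<le> card (?M W)"
    proof (rule card_inj_on_le[OF _ _ finM])
      show "inj_on (\<lambda>K. K - {v}) ?A"
      proof (rule inj_onI)
        \<comment> \<open>If K and L differ, they differ only in v, and the one lacking v is not
          maximal.\<close>
        have "K \<subseteq> L" if KL: "K \<in> ?A" "L \<in> ?A" "K - {v} = L - {v}" for K L
        proof (rule ccontr)
          assume "\<not> K \<subseteq> L"
          then have "v \<notin> L" "K = insert v L" using KL(3) by auto
          then show False using KL(1,2) by (auto simp: max_indep_def)
        qed
        then show "K = L" if "K \<in> ?A" "L \<in> ?A" "K - {v} = L - {v}" for K L
          using that by (metis (no_types, lifting) subset_antisym)
      qed
    qed auto
    also have "\<dots> \<le> 1 + (card W)\<^sup>2 * 2 ^ k" using insert by simp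
    also have "card ?B \<le> card W * 2 ^ k"
    proof (rule card_UN_le_mult)
      show "finite ?U" "card ?U \<le> card W" using insert by (auto intro: card_mono)
      fix u assume "u \<in> ?U"
      then have "card (common_nonneighbours R V u v) \<le> k" using few insert.prems by auto
      then have "card (Pow (common_nonneighbours R V u v)) \<le> 2 ^ k" using fin by (simp add: card_Pow)
      then show "card (insert v ` Pow (common_nonneighbours R V u v)) \<le> 2 ^ k"
        using card_image_le fin by (meson finite_Pow_iff order_trans)
    qed
    finally have "card (?M (insert v W)) \<le> 1 + (card W)\<^sup>2 * 2 ^ k + card W * 2 ^ k" by simp
    also have "\<dots> = 1 + ((card W)\<^sup>2 + card W) * 2 ^ k" by (simp add: algebra_simps)
    also have "\<dots> \<le> 1 + (card (insert v W))\<^sup>2 * 2 ^ k"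
      using insert by (intro add_left_mono mult_right_mono) (auto simp: power2_eq_square)
    finally show ?case .
  qed
qed

text \<open>Padding by repetition lets lists of one fixed length encode all nonempty sets up to that
  size, so a single power of n counts them.\<close>

lemma ex_list_of_length:
  assumes "finite Y" "Y \<noteq> {}" "card Y \<le> m"
  shows "\<exists>xs. set xs = Y \<and> length xs = m"
proof -
  obtain ys where ys: "set ys = Y" "distinct ys" using finite_distinct_list assms(1) by blast
  then have "length ys \<le> m" "ys \<noteq> []" using assms distinct_card[of ys] by auto
  then have "set (ys @ replicate (m - length ys) (hd ys)) = Y"
    "length (ys @ replicate (m - length ys) (hd ys)) = m"
    using ys by (auto simp: set_replicate_conv_if)
  then show ?thesis by blast
qed

text \<open>A set is encoded by a list of length t for the separator, an edge from each side, and
  the sides as subsets of common non-neighbourhoods. Each edge costs n^2, whence the exponent t +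
  4.\<close>

lemma card_split_with_edges_le:
  assumes "finite V" "sym R" "R \<subseteq> V \<times> V" "1 \<le> t"
    and few: "\<And>u v. (u, v) \<in> R \<Longrightarrow> card (common_nonneighbours R V u v) \<le> k"
  shows "card {S. S \<subseteq> V \<and> split_with_edges R t S} \<le> card V ^ (t + 4) * 2 ^ (2 * k)"
proof -
  let ?n = "card V" and ?N = "\<lambda>e. common_nonneighbours R V (fst e) (snd e)"
  let ?L = "{xs. set xs \<subseteq> V \<and> length xs = t}"
  let ?f = "\<lambda>xs (D, D'). set xs \<union> D \<union> D'"
  let ?F = "\<Union>xs \<in> ?L. \<Union>e \<in> R. \<Union>e' \<in> R. ?f xs ` (Pow (?N e) \<times> Pow (?N e'))"
  have finR: "finite R" and cardR: "card R \<le> ?n * ?n"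
    using assms finite_subset[of R "V \<times> V"] card_mono[of "V \<times> V" R]
    by (auto simp: card_cartesian_product)
  have finL: "finite ?L" and cardL: "card ?L \<le> ?n ^ t"
    using assms by (auto simp: card_lists_length_eq intro: finite_lists_length_eq)
  have fin: "finite (?N e)" for e using assms by (simp add: common_nonneighbours_def)
  have "card ?F \<le> ?n ^ t * ((?n * ?n) * ((?n * ?n) * (2 ^ k * 2 ^ k)))"
  proof (rule card_UN_le_mult[OF finL cardL], rule card_UN_le_mult[OF finR cardR],
      rule card_UN_le_mult[OF finR cardR])
    fix xs e e' assume "e \<in> R" "e' \<in> R"
    then have "card (?N e) \<le> k" "card (?N e') \<le> k" using few[of "fst e" "snd e"] few[of "fst e'" "snd e'"] by auto
    then have "card (Pow (?N e) \<times> Pow (?N e')) \<le> 2 ^ k * 2 ^ k"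
      unfolding card_cartesian_product using fin by (intro mult_mono) (auto simp: card_Pow)
    moreover have "card (?f xs ` (Pow (?N e) \<times> Pow (?N e'))) \<le> card (Pow (?N e) \<times> Pow (?N e'))"
      using fin by (intro card_image_le) auto
    ultimately show "card (?f xs ` (Pow (?N e) \<times> Pow (?N e'))) \<le> 2 ^ k * 2 ^ k" by simp
  qed
  also have "\<dots> = ?n ^ (t + 4) * 2 ^ (2 * k)"
  proof -
    have "?n ^ 4 = ?n * ?n * (?n * ?n)" by (simp add: numeral_eq_Suc)
    moreover have "(2 :: nat) ^ (2 * k) = 2 ^ k * 2 ^ k" by (simp add: mult_2 power_add)
    ultimately show ?thesis by (simp only: power_add mult.assoc)
  qed
  finally have F: "card ?F \<le> ?n ^ (t + 4) * 2 ^ (2 * k)" .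
  have "S \<in> ?F" if "S \<subseteq> V" and split: "split_with_edges R t S" for S
  proof -
    obtain X A A' u v u' v' where S: "S = X \<union> A \<union> A'" and "card X \<le> t" and disj: "A \<inter> A' = {}"
      and e: "u \<in> A" "v \<in> A" "(u, v) \<in> R" and e': "u' \<in> A'" "v' \<in> A'" "(u', v') \<in> R"
      and no: "\<And>p q. p \<in> A \<Longrightarrow> q \<in> A' \<Longrightarrow> (p, q) \<notin> R"
      using split unfolding split_with_edges_def indep_def by blast
    \<comment> \<open>Lists of positive length cannot encode the empty set. An empty separator is
      replaced by u, which lies in A, so the union is still S; the size bound uses that t is at
      least 1.\<close>
    define Y where "Y = (if X = {} then {u} else X)"
    have "finite S" using \<open>S \<subseteq> V\<close> \<open>finite V\<close> finite_subset by blast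
    then have "finite Y" "Y \<noteq> {}" "card Y \<le> t" using S \<open>card X \<le> t\<close> \<open>1 \<le> t\<close> by (auto simp: Y_def)
    then obtain xs where xs: "set xs = Y" "length xs = t" using ex_list_of_length by blast
    have no': "(q, p) \<notin> R" if "p \<in> A" "q \<in> A'" for p q using no[OF that] \<open>sym R\<close> by (meson symD)
    \<comment> \<open>The roles cross: the edge in A confines A', and the edge in A' confines
      A.\<close>
    have "A' \<subseteq> ?N (u, v)" "A \<subseteq> ?N (u', v')"
      using S \<open>S \<subseteq> V\<close> disj e e' no no' by (auto simp: common_nonneighbours_def)
    moreover have "S = ?f xs (A', A)" using xs S e by (auto simp: Y_def)
    ultimately have "S \<in> ?f xs ` (Pow (?N (u, v)) \<times> Pow (?N (u', v')))" by blast
    moreover have "xs \<in> ?L" using xs S e \<open>S \<subseteq> V\<close> by (auto simp: Y_def)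
    ultimately show ?thesis using e(3) e'(3) by (intro UN_I)
  qed
  then have sub: "{S. S \<subseteq> V \<and> split_with_edges R t S} \<subseteq> ?F" by (intro subsetI) simp
  have "finite ?F" using finL finR fin by (intro finite_UN_I finite_imageI finite_cartesian_product) auto
  from card_mono[OF this sub] F show ?thesis by (rule order_trans)
qed

text \<open>Lists of length t + 1 encode the cores. A core X fixes the ground set, and
  \<open>card_max_indep_le\<close> bounds the choices of I in it.\<close>

lemma card_max_indep_outside_core_le:
  assumes "finite V" "sym R" "irrefl R" "R \<subseteq> V \<times> V"
    and few: "\<And>u v. (u, v) \<in> R \<Longrightarrow> card (common_nonneighbours R V u v) \<le> k"
  shows "card {X \<union> I |X I. X \<subseteq> V \<and> X \<noteq> {} \<and> card X \<le> Suc t \<and>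
      max_indep R {w \<in> V - X. card {x \<in> X. (w, x) \<in> R} \<le> t} I}
    \<le> card V ^ Suc t * (1 + (card V)\<^sup>2 * 2 ^ k)"
proof -
  let ?n = "card V"
  let ?W = "\<lambda>X. {w \<in> V - X. card {x \<in> X. (w, x) \<in> R} \<le> t}"
  let ?L = "{xs. set xs \<subseteq> V \<and> length xs = Suc t}"
  let ?M = "\<lambda>X. {I. max_indep R (?W X) I}"
  let ?F = "\<Union>xs \<in> ?L. (\<union>) (set xs) ` ?M (set xs)"
  have finL: "finite ?L" and cardL: "card ?L \<le> ?n ^ Suc t"
    using assms finite_lists_length_eq[of V "Suc t"] by (auto simp: card_lists_length_eq)
  have finM: "finite (?M X)" for X
    by (rule finite_subset[of _ "Pow V"]) (use assms in \<open>auto simp: max_indep_def\<close>)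
  have F: "card ?F \<le> ?n ^ Suc t * (1 + ?n\<^sup>2 * 2 ^ k)"
  proof (rule card_UN_le_mult[OF finL cardL])
    fix xs
    have "card ((\<union>) (set xs) ` ?M (set xs)) \<le> card (?M (set xs))"
      using finM by (rule card_image_le)
    also have "\<dots> \<le> 1 + (card (?W (set xs)))\<^sup>2 * 2 ^ k"
      by (rule card_max_indep_le[OF assms(1) _ assms(2,3)]) (use few in auto)
    also have "\<dots> \<le> 1 + ?n\<^sup>2 * 2 ^ k"
    proof -
      have "card (?W (set xs)) \<le> ?n" using assms(1) by (intro card_mono) auto
      then show ?thesis by (simp add: power_mono)
    qed
    finally show "card ((\<union>) (set xs) ` ?M (set xs)) \<le> 1 + ?n\<^sup>2 * 2 ^ k" .
  qed
  have sub: "{X \<union> I |X I. X \<subseteq> V \<and> X \<noteq> {} \<and> card X \<le> Suc t \<and> max_indep R (?W X) I} \<subseteq> ?F"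
  proof (intro subsetI)
    fix S assume "S \<in> {X \<union> I |X I. X \<subseteq> V \<and> X \<noteq> {} \<and> card X \<le> Suc t \<and> max_indep R (?W X) I}"
    then obtain X I where X: "S = X \<union> I" "X \<subseteq> V" "X \<noteq> {}" "card X \<le> Suc t" "max_indep R (?W X) I"
      by blast
    then obtain xs where xs: "set xs = X" "length xs = Suc t"
      using ex_list_of_length[of X "Suc t"] finite_subset[OF X(2) assms(1)] by blast
    show "S \<in> ?F"
    proof (rule UN_I)
      show "xs \<in> ?L" using xs X by simp
      show "S \<in> (\<union>) (set xs) ` ?M (set xs)" using xs X by simp
    qed
  qed
  have "finite ?F" using finL finM by (intro finite_UN_I) auto
  from card_mono[OF this sub] F show ?thesis by (rule order_trans)
qed

text \<open>This serves the list encoding of cores. If X is empty, then S is independent and any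
  single vertex of S can be the core.\<close>

lemma core_nonempty:
  assumes "indep_outside_core R t X S" "S \<noteq> {}" "1 \<le> t"
  shows "\<exists>Y. Y \<noteq> {} \<and> indep_outside_core R t Y S"
proof (cases "X = {}")
  case True
  obtain v where v: "v \<in> S" using assms by blast
  have "card {x \<in> {v}. (w, x) \<in> R} \<le> t" for w
    using card_mono[of "{v}" "{x \<in> {v}. (w, x) \<in> R}"] \<open>1 \<le> t\<close> by force
  then have "indep_outside_core R t {v} S"
    using assms v True unfolding indep_outside_core_def by (auto simp: indep_def)
  then show ?thesis by blast
qed (use assms in blast)

section \<open>Combination of the two counts\<close>

theorem theorem14:
  fixes G :: "'a pair_pre_digraph" and c t n :: nat
  assumes "c \<ge> 1" and "t \<ge> 1"
    and "pair_graph G" and "card (pverts G) = n" and "n \<ge> 1"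
    and "\<exists>H. pair_graph H \<and> c_closed c H \<and> G = graph_complement H"
  shows "card {S. S \<subseteq> pverts G \<and> treewidth (with_proj G \<restriction> S) \<le> int t \<and>
                  (\<forall>S'. S \<subset> S' \<and> S' \<subseteq> pverts G \<longrightarrow> \<not> treewidth (with_proj G \<restriction> S') \<le> int t)}
         \<le> 3 * n ^ (t + 4) * 2 ^ (2 * (c - 1))"
proof -
  interpret pair_graph G by fact
  let ?V = "pverts G" and ?R = "parcs G" and ?k = "c - 1"
  let ?W = "\<lambda>X. {w \<in> ?V - X. card {x \<in> X. (w, x) \<in> ?R} \<le> t}"
  let ?M = "{S. S \<subseteq> ?V \<and> treewidth (with_proj G \<restriction> S) \<le> int t \<and>
      (\<forall>S'. S \<subset> S' \<and> S' \<subseteq> ?V \<longrightarrow> \<not> treewidth (with_proj G \<restriction> S') \<le> int t)}"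
  let ?A = "{S. S \<subseteq> ?V \<and> split_with_edges ?R t S}"
  let ?B = "{X \<union> I |X I. X \<subseteq> ?V \<and> X \<noteq> {} \<and> card X \<le> Suc t \<and> max_indep ?R (?W X) I}"
  have sym: "sym ?R" using pair_sym_arcs by (simp add: symmetric_def)
  have irrefl: "irrefl ?R" using pair_no_loops by (force simp: irrefl_def)
  have sub: "?R \<subseteq> ?V \<times> ?V" by (auto dest: in_arcsD1 in_arcsD2)
  have fin: "finite ?V" by (rule pair_finite_verts)
  have few: "card (common_nonneighbours ?R ?V u v) \<le> ?k" if uv: "(u, v) \<in> ?R" for u v
  proof -
    obtain H where H: "pair_graph H" "c_closed c H" "G = graph_complement H" using assms(6) by blast
    interpret H: pair_graph H by (rule H(1))
    have V: "u \<in> pverts H" "v \<in> pverts H" "u \<noteq> v" "(u, v) \<notin> parcs H"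
      using uv H(3) by (auto simp: graph_complement_def)
    \<comment> \<open>Complementation turns common non-neighbours in G into common neighbours in H;
      u and v drop out on the right because H has no loops.\<close>
    have "common_nonneighbours ?R ?V u v = {w \<in> pverts H. (u, w) \<in> parcs H \<and> (v, w) \<in> parcs H}"
      using V H(3) H.pair_no_loops by (force simp: common_nonneighbours_def graph_complement_def)
    then show ?thesis using H(2) V unfolding c_closed_def by simp
  qed
  have "?M \<subseteq> ?A \<union> ?B"
  proof (intro subsetI)
    fix S assume "S \<in> ?M"
    then have S: "S \<subseteq> ?V" "treewidth (with_proj G \<restriction> S) \<le> int t"
      and maximal: "\<And>S'. S \<subset> S' \<Longrightarrow> S' \<subseteq> ?V \<Longrightarrow> \<not> treewidth (with_proj G \<restriction> S') \<le> int t"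
      by auto
    have finS: "finite S" using S fin finite_subset by blast
    show "S \<in> ?A \<union> ?B"
    proof (cases "split_with_edges ?R t S")
      case False
      \<comment> \<open>A single vertex is its own core, so the empty set is not maximal when n is
        at least 1.\<close>
      have "S \<noteq> {}"
      proof
        assume "S = {}"
        obtain v where v: "v \<in> ?V" using assms(4,5) by fastforce
        have "indep_outside_core ?R t {v} {v}" by (simp add: indep_outside_core_def indep_def)
        then have "treewidth (with_proj G \<restriction> {v}) \<le> int t"
          using core_imp_treewidth_le[OF assms(3)] by blast
        with maximal[of "{v}"] v \<open>S = {}\<close> show False by auto
      qed
      with False obtain X where "X \<noteq> {}" and core: "indep_outside_core ?R t X S"
        using treewidth_le_imp_split_or_core[OF assms(3) finS S(2)] core_nonempty assms(2) by metis
      then have X: "X \<subseteq> S" "card X \<le> Suc t" "indep ?R (S - X)" "S - X \<subseteq> ?W X"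
        using S(1) by (auto simp: indep_outside_core_def)
      \<comment> \<open>Otherwise X would be a core of the larger set \<open>insert w S\<close> as
        well, against the maximality of S.\<close>
      have "\<not> indep ?R (insert w (S - X))" if w: "w \<in> ?W X - (S - X)" for w
      proof
        assume "indep ?R (insert w (S - X))"
        moreover have "insert w S - X = insert w (S - X)" using w by auto
        ultimately have "indep_outside_core ?R t X (insert w S)"
          using core w unfolding indep_outside_core_def by auto
        then have "treewidth (with_proj G \<restriction> insert w S) \<le> int t"
          using core_imp_treewidth_le[OF assms(3)] finS by blast
        moreover have "S \<subset> insert w S" "insert w S \<subseteq> ?V" using w X S(1) by auto
        ultimately show False using maximal by blast
      qed
      with X have "max_indep ?R (?W X) (S - X)" unfolding max_indep_def by blast
      moreover have "S = X \<union> (S - X)" "X \<subseteq> ?V" using X S(1) by auto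
      ultimately show ?thesis using \<open>X \<noteq> {}\<close> X(2) by blast
    qed (use S in simp)
  qed
  moreover have "finite (?A \<union> ?B)"
    by (rule finite_subset[of _ "Pow ?V"]) (use fin in \<open>auto simp: max_indep_def\<close>)
  ultimately have "card ?M \<le> card (?A \<union> ?B)" by (rule card_mono[rotated])
  also have "\<dots> \<le> card ?A + card ?B" by (rule card_Un_le)
  also have "\<dots> \<le> n ^ (t + 4) * 2 ^ (2 * ?k) + n ^ Suc t * (1 + n\<^sup>2 * 2 ^ ?k)"
    using card_split_with_edges_le[OF fin sym sub assms(2) few]
      card_max_indep_outside_core_le[OF fin sym irrefl sub few, of t] assms(4)
    by (intro add_mono) auto
  \<comment> \<open>Both summands 1 and \<open>n\<^sup>2 * 2 ^ ?k\<close> are at most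
    \<open>n ^ 3 * 2 ^ (2 * ?k)\<close>. The core count is thus at most twice the bound for split
    sets, which gives the factor 3.\<close>
  also have "n ^ Suc t * (1 + n\<^sup>2 * 2 ^ ?k) \<le> n ^ Suc t * (2 * n ^ 3 * 2 ^ (2 * ?k))"
  proof (rule mult_left_mono)
    have "n\<^sup>2 * 2 ^ ?k \<le> n ^ 3 * 2 ^ (2 * ?k)"
      using assms(5) by (intro mult_mono power_increasing) auto
    moreover have "1 \<le> n ^ 3 * 2 ^ (2 * ?k)" using assms(5) by simp
    ultimately show "1 + n\<^sup>2 * 2 ^ ?k \<le> 2 * n ^ 3 * 2 ^ (2 * ?k)" by linarith
  qed simp
  also have "n ^ Suc t * (2 * n ^ 3 * 2 ^ (2 * ?k)) = 2 * (n ^ (t + 4) * 2 ^ (2 * ?k))"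
  proof -
    have "n ^ (t + 4) = n ^ Suc t * n ^ 3" by (simp add: power_add numeral_eq_Suc)
    then show ?thesis by simp
  qed
  finally show ?thesis by simp
qed

end
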